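(* Let $n\ge 2$, let $N=\{1,\dots,n\}$, and let $F_1,\dots,F_n$ be (cumulative distribution functions of) marginal distributions on $[0,\infty)$. Write $\overline F_i(x)=1-F_i(x)$. A jointly exclusive random vector $X_N=(X_1,\dots,X_n)$ with marginals $F_1,\dots,F_n$ exists if and only if $$\sum_{i\in N}\overline F_i(0)\le n-1.$$
   Context: A non-negative random vector $X_N=(X_1,\dots,X_n)$ is called jointly exclusive (JE) if $\mathbb{P}(X_1>0,\dots,X_n>0)=0$, equivalently $\prod_{i\in N}X_i=0$ almost surely. "With marginals $F_1,\dots,F_n$" means that $X_i$ has cumulative distribution function $F_i$ for each $i\in N$. *)

theory Defs
  imports "HOL-Probability.Probability"
begin

definition nonneg_cdf :: "(real \<Rightarrow> real) \<Rightarrow> bool" where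
  "nonneg_cdf F \<longleftrightarrow>
     (\<exists>\<mu>. real_distribution \<mu> \<and> measure \<mu> {0..} = 1 \<and> cdf \<mu> = F)"

definition survival :: "(real \<Rightarrow> real) \<Rightarrow> real \<Rightarrow> real" where
  "survival F x = 1 - F x"

text \<open>A random vector is a family of random variables indexed by \<open>N\<close>, all defined on
  the same probability space; \<open>X i\<close> is irrelevant for \<open>i \<notin> N\<close>.\<close>

definition nonneg_random_vector ::
    "'a measure \<Rightarrow> 'i set \<Rightarrow> ('i \<Rightarrow> 'a \<Rightarrow> real) \<Rightarrow> bool" where
  "nonneg_random_vector M N X \<longleftrightarrow>
     prob_space M \<and>
     (\<forall>i\<in>N. X i \<in> borel_measurable M \<and> (\<forall>\<omega>\<in>space M. 0 \<le> X i \<omega>))"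

definition jointly_exclusive ::
    "'a measure \<Rightarrow> 'i set \<Rightarrow> ('i \<Rightarrow> 'a \<Rightarrow> real) \<Rightarrow> bool" where
  "jointly_exclusive M N X \<longleftrightarrow>
     nonneg_random_vector M N X \<and> \<P>(\<omega> in M. \<forall>i\<in>N. 0 < X i \<omega>) = 0"

definition has_marginals ::
    "'a measure \<Rightarrow> 'i set \<Rightarrow> ('i \<Rightarrow> 'a \<Rightarrow> real) \<Rightarrow> ('i \<Rightarrow> real \<Rightarrow> real) \<Rightarrow> bool" where
  "has_marginals M N X F \<longleftrightarrow> (\<forall>i\<in>N. cdf (distr M borel (X i)) = F i)"

end

theory Submission
  imports Defs
begin

text \<open>The events \<open>X i = 0\<close> cover the sample space almost surely when the vector is jointly exclusive,
  so their probabilities \<open>F i 0\<close> sum to at least 1. Conversely, let \<open>U\<close> be uniform on \<open>(0,1)\<close> and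
  let \<open>X i\<close> be the quantile function of \<open>F i\<close> at \<open>U - (F 1 0 + \<dots> + F (i-1) 0)\<close> modulo 1, the
  subtracted sum being capped at 1. As
  the quantile function vanishes on \<open>(0, F i 0]\<close>, consecutive intervals of length \<open>F i 0\<close> are the zero
  sets, and these cover \<open>(0,1)\<close> if their lengths sum to at least 1.\<close>

section \<open>Necessity of the inequality\<close>

lemma jointly_exclusive_imp_sum_survival_le:
  assumes "finite N" and je: "jointly_exclusive M N X" and marg: "has_marginals M N X F"
  shows "(\<Sum>i\<in>N. survival (F i) 0) \<le> real (card N) - 1"
proof -
  interpret prob_space M
    using je by (simp add: jointly_exclusive_def nonneg_random_vector_def)
  have [measurable]: "X i \<in> borel_measurable M" if "i \<in> N" for i
    using je that by (simp add: jointly_exclusive_def nonneg_random_vector_def)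
  note [measurable] = \<open>finite N\<close>[THEN countable_finite]
  have F: "F i 0 = \<P>(\<omega> in M. X i \<omega> \<le> 0)" if "i \<in> N" for i
  proof -
    have "F i 0 = measure (distr M borel (X i)) {..0}"
      using marg that unfolding has_marginals_def cdf_def by metis
    also have "\<dots> = \<P>(\<omega> in M. X i \<omega> \<le> 0)"
      using that by (subst measure_distr) (auto intro!: arg_cong[where f="measure M"])
    finally show ?thesis .
  qed
  \<comment> \<open>The complement of the null all-positive event is the union of the zero sets, so
    the union bound applies.\<close>
  have "1 = prob (space M - {\<omega>\<in>space M. \<forall>i\<in>N. 0 < X i \<omega>})"
    using je by (subst prob_compl) (auto simp: jointly_exclusive_def)
  also have "space M - {\<omega>\<in>space M. \<forall>i\<in>N. 0 < X i \<omega>} = (\<Union>i\<in>N. {\<omega>\<in>space M. X i \<omega> \<le> 0})"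
    by (auto simp: not_less)
  also have "prob \<dots> \<le> (\<Sum>i\<in>N. \<P>(\<omega> in M. X i \<omega> \<le> 0))"
    using \<open>finite N\<close> by (intro finite_measure_subadditive_finite) auto
  also have "\<dots> = (\<Sum>i\<in>N. F i 0)"
    using F by simp
  finally show ?thesis
    by (simp add: survival_def sum_subtractf)
qed

section \<open>Transfer to a fixed sample space type\<close>

text \<open>Both properties depend only on the joint law, so \<open>M\<close> may be replaced by its
  image under the vector itself, with coordinate maps as the new variables.\<close>

lemma jointly_exclusive_on_function_space:
  fixes X :: "'i \<Rightarrow> 'a \<Rightarrow> real"
  assumes je: "jointly_exclusive M N X" and marg: "has_marginals M N X F" and "finite N"
  shows "\<exists>(M' :: ('i \<Rightarrow> real) measure) X'.
    jointly_exclusive M' N X' \<and> has_marginals M' N X' F"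
proof -
  interpret prob_space M
    using je by (simp add: jointly_exclusive_def nonneg_random_vector_def)
  have X [measurable]: "X i \<in> borel_measurable M" if "i \<in> N" for i
    using je that by (simp add: jointly_exclusive_def nonneg_random_vector_def)
  have nonneg: "0 \<le> X i \<omega>" if "i \<in> N" "\<omega> \<in> space M" for i \<omega>
    using je that by (simp add: jointly_exclusive_def nonneg_random_vector_def)
  note [measurable] = \<open>finite N\<close>[THEN countable_finite]
  let ?B = "PiM (UNIV :: 'i set) (\<lambda>_. borel :: real measure)"
  define g where "g = (\<lambda>\<omega> i. if i \<in> N then X i \<omega> else 0)"
  have g [measurable]: "g \<in> measurable M ?B"
  proof (rule measurable_PiM_single')
    show "(\<lambda>\<omega>. g \<omega> i) \<in> borel_measurable M" for i
      using X by (cases "i \<in> N") (auto simp: g_def)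
  qed auto
  \<comment> \<open>Nonnegativity is demanded at every sample point, and the function space contains
    points with negative coordinates. Truncation changes nothing on the range of \<open>g\<close> at
    indices in \<open>N\<close>.\<close>
  define X' where "X' = (\<lambda>i (f :: 'i \<Rightarrow> real). max 0 (f i))"
  have X' [measurable]: "X' i \<in> borel_measurable ?B" for i
    unfolding X'_def by measurable
  have X'g: "X' i (g \<omega>) = X i \<omega>" if "i \<in> N" "\<omega> \<in> space M" for i \<omega>
    using nonneg[OF that] that by (simp add: X'_def g_def)
  have "\<P>(f in distr M ?B g. \<forall>i\<in>N. 0 < X' i f) = \<P>(\<omega> in M. \<forall>i\<in>N. 0 < X' i (g \<omega>))"
  proof (subst measure_distr)
    show "{f \<in> space (distr M ?B g). \<forall>i\<in>N. 0 < X' i f} \<in> sets ?B"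
      unfolding space_distr by measurable
    show "prob (g -` {f \<in> space (distr M ?B g). \<forall>i\<in>N. 0 < X' i f} \<inter> space M)
      = \<P>(\<omega> in M. \<forall>i\<in>N. 0 < X' i (g \<omega>))"
      by (rule arg_cong[where f=prob]) (auto simp: space_PiM)
  qed (rule g)
  also have "\<dots> = \<P>(\<omega> in M. \<forall>i\<in>N. 0 < X i \<omega>)"
    by (rule arg_cong[where f=prob]) (auto simp: X'g)
  finally have "\<P>(f in distr M ?B g. \<forall>i\<in>N. 0 < X' i f) = 0"
    using je by (simp add: jointly_exclusive_def)
  then have "jointly_exclusive (distr M ?B g) N X'"
    using g by (auto simp: jointly_exclusive_def nonneg_random_vector_def X'_def
        intro!: prob_space_distr)
  moreover have "distr (distr M ?B g) borel (X' i) = distr M borel (X i)" if "i \<in> N" for i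
    using that by (subst distr_distr) (auto intro!: distr_cong simp: X'g)
  then have "has_marginals (distr M ?B g) N X' F"
    using marg by (simp add: has_marginals_def)
  ultimately show ?thesis
    by blast
qed

section \<open>Rotations of the uniform distribution\<close>

abbreviation unif :: "real measure" where
  "unif \<equiv> restrict_space lborel {0<..<1}"

lemma prob_space_unif: "prob_space unif"
  by (auto simp: emeasure_restrict_space space_restrict_space intro!: prob_spaceI)

lemma emeasure_lborel_vimage_plus:
  assumes "S \<in> sets (borel :: real measure)"
  shows "emeasure lborel ((\<lambda>x. c + x) -` S) = emeasure lborel S"
proof -
  have "emeasure lborel ((\<lambda>x. c + x) -` S) = emeasure (distr lborel borel ((+) c)) S"
    using assms by (subst emeasure_distr) auto
  then show ?thesis
    by (simp add: lborel_distr_plus)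
qed

text \<open>The value \<open>1/2\<close> at the null set \<open>u = a\<close> only serves to keep the rotation inside \<open>(0,1)\<close>.\<close>

definition rot :: "real \<Rightarrow> real \<Rightarrow> real" where
  "rot a u = (if a < u then u - a else if u < a then u - a + 1 else 1/2)"

lemma rot_in_unit: "0 \<le> a \<Longrightarrow> a \<le> 1 \<Longrightarrow> u \<in> {0<..<1} \<Longrightarrow> rot a u \<in> {0<..<1}"
  by (auto simp: rot_def)

lemma measurable_rot:
  assumes "0 \<le> a" "a \<le> 1"
  shows "rot a \<in> measurable unif unif"
proof (rule measurable_restrict_space2)
  show "rot a \<in> space unif \<rightarrow> {0<..<1}"
    using rot_in_unit[OF assms] by (auto simp: space_restrict_space)
  have "rot a \<in> measurable borel borel"
    unfolding rot_def by measurable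
  then show "rot a \<in> measurable unif lborel"
    by (auto intro: measurable_restrict_space1)
qed

text \<open>Up to the null point \<open>a\<close>, the rotation translates \<open>(a,1)\<close> onto
  \<open>(0,1-a)\<close> and \<open>(0,a)\<close> onto \<open>(1-a,1)\<close>, and Lebesgue measure
  is translation invariant.\<close>

lemma distr_rot:
  assumes a: "0 \<le> a" "a \<le> 1"
  shows "distr unif unif (rot a) = unif"
proof (rule measure_eqI)
  fix A assume "A \<in> sets (distr unif unif (rot a))"
  then have A: "A \<in> sets borel" "A \<subseteq> {0<..<1}"
    by (auto simp: sets_restrict_space_iff)
  \<comment> \<open>\<open>lo\<close> is reached from \<open>u > a\<close> and \<open>hi\<close>
    from \<open>u < a\<close>; together they miss at most the null point \<open>1 - a\<close> of
    \<open>A\<close>.\<close>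
  define lo hi where "lo = A \<inter> {0<..<1 - a}" and "hi = A \<inter> {1 - a<..<1}"
  have [measurable]: "A \<in> sets borel" "lo \<in> sets borel" "hi \<in> sets borel"
    using A by (auto simp: lo_def hi_def)
  have meas_rot [measurable]: "rot a \<in> measurable borel borel"
    unfolding rot_def by measurable
  have "emeasure (distr unif unif (rot a)) A = emeasure unif (rot a -` A \<inter> {0<..<1})"
    using A by (subst emeasure_distr[OF measurable_rot[OF a]])
      (auto simp: sets_restrict_space_iff space_restrict_space)
  also have "\<dots> = emeasure lborel (rot a -` A \<inter> {0<..<1})"
    by (subst emeasure_restrict_space) auto
  also have "\<dots> = emeasure lborel ((\<lambda>u. - a + u) -` lo \<union> (\<lambda>u. (1 - a) + u) -` hi)"
  proof (rule emeasure_eq_AE)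
    show "AE u in lborel. u \<in> rot a -` A \<inter> {0<..<1} \<longleftrightarrow>
        u \<in> (\<lambda>u. - a + u) -` lo \<union> (\<lambda>u. (1 - a) + u) -` hi"
      using AE_lborel_singleton[of a]
    proof eventually_elim
      case (elim u)
      have "u - a \<in> A \<Longrightarrow> 0 < u - a \<and> u - a < 1" "u - a + 1 \<in> A \<Longrightarrow> 0 < u - a + 1 \<and> u - a + 1 < 1"
        using A(2) by auto
      with elim a show ?case
        by (auto simp: rot_def lo_def hi_def algebra_simps)
    qed
    show "rot a -` A \<inter> {0<..<1} \<in> sets lborel"
      using measurable_sets[OF meas_rot A(1)] by auto
    show "(\<lambda>u. - a + u) -` lo \<union> (\<lambda>u. (1 - a) + u) -` hi \<in> sets lborel"
      using measurable_sets[of "\<lambda>u. - a + u" borel borel lo]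
        measurable_sets[of "\<lambda>u. (1 - a) + u" borel borel hi] by auto
  qed
  also have "\<dots> = emeasure lborel ((\<lambda>u. - a + u) -` lo) + emeasure lborel ((\<lambda>u. (1 - a) + u) -` hi)"
    using measurable_sets[of "\<lambda>u. - a + u" borel borel lo]
        measurable_sets[of "\<lambda>u. (1 - a) + u" borel borel hi]
    by (intro plus_emeasure[symmetric]) (auto simp: lo_def hi_def)
  also have "\<dots> = emeasure lborel lo + emeasure lborel hi"
    by (simp only: emeasure_lborel_vimage_plus \<open>lo \<in> sets borel\<close> \<open>hi \<in> sets borel\<close>)
  also have "\<dots> = emeasure lborel (lo \<union> hi)"
    by (rule plus_emeasure) (auto simp: lo_def hi_def A)
  also have "\<dots> = emeasure lborel A"
  proof (rule emeasure_eq_AE)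
    show "AE u in lborel. u \<in> lo \<union> hi \<longleftrightarrow> u \<in> A"
      using AE_lborel_singleton[of "1 - a"]
    proof eventually_elim
      case (elim u)
      then show ?case
        using A(2) by (auto simp: lo_def hi_def)
    qed
  qed auto
  also have "\<dots> = emeasure unif A"
    using A by (subst emeasure_restrict_space) auto
  finally show "emeasure (distr unif unif (rot a)) A = emeasure unif A" .
qed simp

section \<open>Quantile functions\<close>

text \<open>The witness is the generalized inverse \<open>I\<close> of the cdf \<open>C\<close>. On
  \<open>(0,1)\<close> it satisfies \<open>v \<le> C x\<close> iff \<open>I v \<le> x\<close>;
  taking \<open>x = 0\<close> locates its zeros.\<close>

lemma nonneg_cdf_quantile:
  assumes "nonneg_cdf F"
  obtains Q where "Q \<in> borel_measurable unif" "cdf (distr unif borel Q) = F"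
    and "\<And>v. v \<in> {0<..<1} \<Longrightarrow> 0 \<le> Q v"
    and "\<And>v. v \<in> {0<..<1} \<Longrightarrow> v \<le> F 0 \<Longrightarrow> Q v \<le> 0"
proof -
  obtain \<mu> where \<mu>: "real_distribution \<mu>" "measure \<mu> {0..} = 1" "cdf \<mu> = F"
    using assms by (auto simp: nonneg_cdf_def)
  interpret cdf_distribution \<mu>
    unfolding cdf_distribution_def by fact
  have C_neg: "C x = 0" if "x < 0" for x
  proof -
    have "prob {..x} \<le> prob (space \<mu> - {0..})"
      using that by (intro finite_measure_mono) (auto simp: sets_eq_imp_space_eq[OF events_eq_borel])
    also have "\<dots> = 0"
      using \<mu>(2) by (subst prob_compl) auto
    finally show ?thesis
      by (simp add: cdf_def measure_le_0_iff)
  qed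
  show ?thesis
  proof (rule that[of I])
    show "I \<in> borel_measurable unif"
      using measurable_CI by (simp cong: measurable_cong_sets sets_restrict_space_cong)
    show "cdf (distr unif borel I) = F"
      by (subst distr_I_eq_M) (rule \<mu>(3))
    \<comment> \<open>A negative \<open>I v\<close> would force
      \<open>v \<le> C (I v) = 0\<close>.\<close>
    show "0 \<le> I v" if "v \<in> {0<..<1}" for v
      using that C_neg[of "I v"] pseudoinverse[of v "I v"] by force
    show "I v \<le> 0" if "v \<in> {0<..<1}" "v \<le> F 0" for v
      using that pseudoinverse[of v 0] \<mu>(3) by simp
  qed
qed

section \<open>Construction from one uniform variable\<close>

text \<open>Selects the coordinate that will vanish at \<open>u\<close>. In the induction, either
  the first \<open>n\<close> terms already reach \<open>u\<close>, or the added term does.\<close>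

lemma sum_ge_imp_partial_sum_crosses:
  fixes p :: "nat \<Rightarrow> real"
  assumes "0 < u" "u \<le> (\<Sum>j=1..n. p j)"
  obtains i where "i \<in> {1..n}" "(\<Sum>j=1..<i. p j) < u" "u \<le> (\<Sum>j=1..<i. p j) + p i"
proof -
  have "\<exists>i\<in>{1..n}. (\<Sum>j=1..<i. p j) < u \<and> u \<le> (\<Sum>j=1..<i. p j) + p i"
    using assms(2)
  proof (induction n)
    case 0
    then show ?case
      using \<open>0 < u\<close> by simp
  next
    case (Suc n)
    show ?case
    proof (cases "u \<le> (\<Sum>j=1..n. p j)")
      case True
      with Suc.IH show ?thesis
        by force
    next
      case False
      with Suc.prems show ?thesis
        by (intro bexI[of _ "Suc n"]) (auto simp: atLeastLessThanSuc_atLeastAtMost)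
    qed
  qed
  then show ?thesis
    using that by blast
qed

lemma sum_survival_le_imp_jointly_exclusive:
  assumes F: "\<And>i. i \<in> {1..n} \<Longrightarrow> nonneg_cdf (F i)"
    and le: "(\<Sum>i\<in>{1..n}. survival (F i) 0) \<le> real n - 1"
  shows "\<exists>X. jointly_exclusive unif {1..n} X \<and> has_marginals unif {1..n} X F"
proof -
  interpret prob_space unif
    by (rule prob_space_unif)
  have "\<forall>i\<in>{1..n}. \<exists>Q. Q \<in> borel_measurable unif \<and> cdf (distr unif borel Q) = F i \<and>
      (\<forall>v\<in>{0<..<1}. 0 \<le> Q v \<and> (v \<le> F i 0 \<longrightarrow> Q v \<le> 0))"
  proof
    fix i assume "i \<in> {1..n}"
    from nonneg_cdf_quantile[OF F[OF this]]
    show "\<exists>Q. Q \<in> borel_measurable unif \<and> cdf (distr unif borel Q) = F i \<and>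
      (\<forall>v\<in>{0<..<1}. 0 \<le> Q v \<and> (v \<le> F i 0 \<longrightarrow> Q v \<le> 0))"
      by metis
  qed
  from bchoice[OF this] obtain Q where Q: "\<And>i. i \<in> {1..n} \<Longrightarrow> Q i \<in> borel_measurable unif"
    "\<And>i. i \<in> {1..n} \<Longrightarrow> cdf (distr unif borel (Q i)) = F i"
    "\<And>i v. i \<in> {1..n} \<Longrightarrow> v \<in> {0<..<1} \<Longrightarrow> 0 \<le> Q i v"
    "\<And>i v. i \<in> {1..n} \<Longrightarrow> v \<in> {0<..<1} \<Longrightarrow> v \<le> F i 0 \<Longrightarrow> Q i v \<le> 0"
    by blast
  have F0: "0 \<le> F i 0" if "i \<in> {1..n}" for i
    using F[OF that] by (metis nonneg_cdf_def cdf_def2 measure_nonneg)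
  have sum_ge: "1 \<le> (\<Sum>j=1..n. F j 0)"
    using le by (simp add: survival_def sum_subtractf)
  \<comment> \<open>The cap keeps the shift in \<open>[0,1]\<close>, as \<open>rot\<close> requires;
    at shift 1 the rotation is the identity on \<open>(0,1)\<close>.\<close>
  define a where "a i = min 1 (\<Sum>j=1..<i. F j 0)" for i
  have a: "0 \<le> a i" "a i \<le> 1" if "i \<in> {1..n}" for i
    using that by (auto simp: a_def intro!: sum_nonneg F0)
  define X where "X i u = Q i (rot (a i) u)" for i u
  have X: "X i \<in> borel_measurable unif" if "i \<in> {1..n}" for i
    unfolding X_def using measurable_compose[OF measurable_rot[OF a] Q(1)] that by simp
  \<comment> \<open>A rotated uniform variable is again uniform, so each marginal is
    preserved.\<close>
  have "distr unif borel (X i) = distr unif borel (Q i)" if i: "i \<in> {1..n}" for i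
  proof -
    have "distr (distr unif unif (rot (a i))) borel (Q i) = distr unif borel (X i)"
      using distr_distr[OF Q(1)[OF i] measurable_rot[OF a[OF i]]] by (simp add: X_def[abs_def] comp_def)
    then show ?thesis
      by (simp add: distr_rot[OF a[OF i]])
  qed
  then have "has_marginals unif {1..n} X F"
    by (simp add: has_marginals_def Q(2))
  \<comment> \<open>This holds at every sample point, so the all-positive event is empty, not merely
    null.\<close>
  moreover have "\<exists>i\<in>{1..n}. X i u \<le> 0" if u: "u \<in> {0<..<1}" for u
  proof -
    have "u \<le> (\<Sum>j=1..n. F j 0)"
      using sum_ge u by simp
    then obtain i where i: "i \<in> {1..n}" "(\<Sum>j=1..<i. F j 0) < u" "u \<le> (\<Sum>j=1..<i. F j 0) + F i 0"
      using sum_ge_imp_partial_sum_crosses[of u "\<lambda>j. F j 0" n] u by auto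
    \<comment> \<open>The partial sum lies below \<open>u < 1\<close>, so the cap is inactive and
      the first branch of \<open>rot\<close> applies. The value is at most \<open>F i 0\<close>,
      where \<open>Q i\<close> vanishes.\<close>
    then have "rot (a i) u = u - (\<Sum>j=1..<i. F j 0)"
      using u by (simp add: rot_def a_def)
    then have "X i u \<le> 0"
      unfolding X_def using i(3) by (intro Q(4) i(1) rot_in_unit a u) simp
    then show ?thesis
      using i(1) by blast
  qed
  then have "\<not> (\<forall>i\<in>{1..n}. 0 < X i u)" if "u \<in> space unif" for u
    using that unfolding space_restrict_space by (meson IntD1 linorder_not_less)
  then have "{u \<in> space unif. \<forall>i\<in>{1..n}. 0 < X i u} = {}"
    by blast
  then have "\<P>(u in unif. \<forall>i\<in>{1..n}. 0 < X i u) = 0"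
    by (simp only: measure_empty)
  moreover have "0 \<le> X i u" if "i \<in> {1..n}" "u \<in> space unif" for i u
    using that Q(3)[OF that(1) rot_in_unit[OF a[OF that(1)]]]
    by (simp add: X_def space_restrict_space)
  ultimately show ?thesis
    using X prob_space_unif
    unfolding jointly_exclusive_def nonneg_random_vector_def by blast
qed

(* HOL cannot quantify over the type of the sample space. Existence is stated for sample
   spaces of type nat => real, the type carrying the law of the vector; the second conjunct
   states the "only if" direction for a sample space of arbitrary type 'a. *)
theorem theorem3p1:
  fixes n :: nat and F :: "nat \<Rightarrow> real \<Rightarrow> real"
  assumes "n \<ge> 2"
    and "\<And>i. i \<in> {1..n} \<Longrightarrow> nonneg_cdf (F i)"
  shows "((\<exists>(M :: (nat \<Rightarrow> real) measure) X.
             jointly_exclusive M {1..n} X \<and> has_marginals M {1..n} X F)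
           \<longleftrightarrow> (\<Sum>i\<in>{1..n}. survival (F i) 0) \<le> real n - 1)
       \<and> ((\<exists>(M :: 'a measure) X.
             jointly_exclusive M {1..n} X \<and> has_marginals M {1..n} X F)
           \<longrightarrow> (\<Sum>i\<in>{1..n}. survival (F i) 0) \<le> real n - 1)"
proof -
  have suf: "\<exists>(M :: (nat \<Rightarrow> real) measure) X. jointly_exclusive M {1..n} X \<and> has_marginals M {1..n} X F"
    if "(\<Sum>i\<in>{1..n}. survival (F i) 0) \<le> real n - 1"
    using sum_survival_le_imp_jointly_exclusive[OF assms(2) that] jointly_exclusive_on_function_space
    by blast
  show ?thesis
    by (intro conjI iffI impI suf)
      (auto dest: jointly_exclusive_imp_sum_survival_le[rotated])
qed

end
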